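(* Let $G$ be a group with finite generating set $\mathcal G$. Suppose that the set of all geodesic words in $(\mathcal G^{\pm 1})^*$ for $G$ is a regular language, and that one can construct the corresponding finite state automaton (that is, a finite state automaton accepting exactly this language). Then the following problem (Problem 2) is solvable in linear time and constant space: given a geodesic word $u\in(\mathcal G^{\pm 1})^*$ and a generator $x\in\mathcal G$, decide whether $\ell(ux)>\ell(u)$.
   Context: The group $G$ and the finite generating set $\mathcal G$ are fixed. For a word $w\in(\mathcal G^{\pm 1})^*$, $\ell(w)$ denotes the minimal length of a word in $(\mathcal G^{\pm 1})^*$ representing the same element of $G$ as $w$. A word $u$ is geodesic if its length equals $\ell(u)$. Linear time is measured in the length of the input word, and constant space refers to working memory (not counting the input), with a bound that may depend on $G$, $\mathcal G$ and the automaton but not on the input. *)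

theory Defs
  imports "HOL-Algebra.Generated_Groups"
begin

text \<open>
  The letters of the alphabet built from a generating set \<open>S\<close> are formal symbols: a generator
  and its formal inverse are different letters even if they represent the same group element.
\<close>

datatype 'a letter = Gen 'a | GenInv 'a

definition letters :: "'a set \<Rightarrow> 'a letter set" where
  "letters S = Gen ` S \<union> GenInv ` S"

fun letter_val :: "('a, 'm) monoid_scheme \<Rightarrow> 'a letter \<Rightarrow> 'a" where
  "letter_val G (Gen g) = g"
| "letter_val G (GenInv g) = inv\<^bsub>G\<^esub> g"

fun word_val :: "('a, 'm) monoid_scheme \<Rightarrow> 'a letter list \<Rightarrow> 'a" where
  "word_val G [] = \<one>\<^bsub>G\<^esub>"
| "word_val G (a # w) = letter_val G a \<otimes>\<^bsub>G\<^esub> word_val G w"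

definition word_length :: "('a, 'm) monoid_scheme \<Rightarrow> 'a set \<Rightarrow> 'a letter list \<Rightarrow> nat" where
  "word_length G S w =
     (LEAST n. \<exists>v \<in> lists (letters S). word_val G v = word_val G w \<and> length v = n)"

definition geodesic :: "('a, 'm) monoid_scheme \<Rightarrow> 'a set \<Rightarrow> 'a letter list \<Rightarrow> bool" where
  "geodesic G S u \<longleftrightarrow> u \<in> lists (letters S) \<and> length u = word_length G S u"


text \<open>
  Finite state automata may be nondeterministic and partial; deterministic (complete or partial)
  automata are the special case in which \<open>fsa_trans\<close> is the graph of a (partial) function and
  \<open>fsa_init\<close> is a singleton.
\<close>

record ('q, 'i) fsa =
  fsa_states :: "'q set"
  fsa_init :: "'q set"
  fsa_trans :: "('q \<times> 'i \<times> 'q) set"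
  fsa_final :: "'q set"

definition finite_state_automaton :: "'i set \<Rightarrow> ('q, 'i) fsa \<Rightarrow> bool" where
  "finite_state_automaton \<Sigma> A \<longleftrightarrow>
     finite \<Sigma> \<and> finite (fsa_states A) \<and>
     fsa_init A \<subseteq> fsa_states A \<and> fsa_final A \<subseteq> fsa_states A \<and>
     fsa_trans A \<subseteq> fsa_states A \<times> \<Sigma> \<times> fsa_states A"

fun fsa_path :: "('q, 'i) fsa \<Rightarrow> 'q \<Rightarrow> 'i list \<Rightarrow> 'q \<Rightarrow> bool" where
  "fsa_path A p [] q \<longleftrightarrow> p = q"
| "fsa_path A p (a # w) q \<longleftrightarrow> (\<exists>r. (p, a, r) \<in> fsa_trans A \<and> fsa_path A r w q)"

definition fsa_language :: "('q, 'i) fsa \<Rightarrow> 'i list set" where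
  "fsa_language A = {w. \<exists>p \<in> fsa_init A. \<exists>q \<in> fsa_final A. fsa_path A p w q}"


text \<open>
  The model of computation is the deterministic Turing machine with a read-only two-way input
  tape, delimited by end markers, and one read-write work tape that is infinite in both
  directions.  Only cells of the work tape count as space.
\<close>

datatype 'i input_cell = LeftEnd | Symbol 'i | RightEnd

datatype move = MoveLeft | Stay | MoveRight

record ('q, 'i, 'b) tm =
  tm_states :: "'q set"
  tm_work_alphabet :: "'b set"
  tm_blank :: 'b
  tm_start :: 'q
  tm_accept :: 'q
  tm_reject :: 'q
  tm_delta :: "'q \<Rightarrow> 'i input_cell \<Rightarrow> 'b \<Rightarrow> 'q \<times> 'b \<times> move \<times> move"
    \<comment> \<open>new state, symbol written, move of the input head, move of the work head\<close>

definition turing_machine :: "'i set \<Rightarrow> ('q, 'i, 'b) tm \<Rightarrow> bool" where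
  "turing_machine \<Sigma> M \<longleftrightarrow>
     finite \<Sigma> \<and> finite (tm_states M) \<and> finite (tm_work_alphabet M) \<and>
     tm_blank M \<in> tm_work_alphabet M \<and>
     {tm_start M, tm_accept M, tm_reject M} \<subseteq> tm_states M \<and>
     tm_accept M \<noteq> tm_reject M \<and>
     (\<forall>q \<in> tm_states M. \<forall>a \<in> {LeftEnd, RightEnd} \<union> Symbol ` \<Sigma>. \<forall>b \<in> tm_work_alphabet M.
        tm_delta M q a b \<in> tm_states M \<times> tm_work_alphabet M \<times> UNIV \<times> UNIV)"

record ('q, 'b) config =
  cfg_state :: 'q
  cfg_input_pos :: nat
  cfg_work_pos :: int
  cfg_work_tape :: "int \<Rightarrow> 'b"

text \<open>Position \<open>0\<close> of the input tape holds the left end marker, the positions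
  \<open>1, \<dots>, length w\<close> hold the input \<open>w\<close>, and position \<open>length w + 1\<close> the right end marker.\<close>

definition input_cell :: "'i list \<Rightarrow> nat \<Rightarrow> 'i input_cell" where
  "input_cell w i =
     (if i = 0 then LeftEnd else if i \<le> length w then Symbol (w ! (i - 1)) else RightEnd)"

fun move_input :: "nat \<Rightarrow> move \<Rightarrow> nat \<Rightarrow> nat" where
  "move_input n MoveLeft i = i - 1"
| "move_input n Stay i = i"
| "move_input n MoveRight i = min (i + 1) (n + 1)"

fun move_work :: "move \<Rightarrow> int \<Rightarrow> int" where
  "move_work MoveLeft j = j - 1"
| "move_work Stay j = j"
| "move_work MoveRight j = j + 1"

definition tm_step :: "('q, 'i, 'b) tm \<Rightarrow> 'i list \<Rightarrow> ('q, 'b) config \<Rightarrow> ('q, 'b) config" where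
  "tm_step M w c =
     (case tm_delta M (cfg_state c) (input_cell w (cfg_input_pos c))
             (cfg_work_tape c (cfg_work_pos c)) of
        (q, b, mi, mw) \<Rightarrow>
          \<lparr>cfg_state = q,
           cfg_input_pos = move_input (length w) mi (cfg_input_pos c),
           cfg_work_pos = move_work mw (cfg_work_pos c),
           cfg_work_tape = (cfg_work_tape c)(cfg_work_pos c := b)\<rparr>)"

definition tm_config :: "('q, 'i, 'b) tm \<Rightarrow> 'i list \<Rightarrow> nat \<Rightarrow> ('q, 'b) config" where
  "tm_config M w t =
     (tm_step M w ^^ t)
       \<lparr>cfg_state = tm_start M, cfg_input_pos = 0, cfg_work_pos = 0,
        cfg_work_tape = (\<lambda>_. tm_blank M)\<rparr>"

definition halted :: "('q, 'i, 'b) tm \<Rightarrow> ('q, 'b) config \<Rightarrow> bool" where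
  "halted M c \<longleftrightarrow> cfg_state c = tm_accept M \<or> cfg_state c = tm_reject M"

definition halts_at :: "('q, 'i, 'b) tm \<Rightarrow> 'i list \<Rightarrow> nat \<Rightarrow> bool" where
  "halts_at M w t \<longleftrightarrow> halted M (tm_config M w t) \<and> (\<forall>s<t. \<not> halted M (tm_config M w s))"

definition work_space :: "('q, 'i, 'b) tm \<Rightarrow> 'i list \<Rightarrow> nat \<Rightarrow> nat" where
  "work_space M w t = card ((\<lambda>s. cfg_work_pos (tm_config M w s)) ` {..t})"

text \<open>
  The decision problem ``given \<open>p \<in> D\<close>, does \<open>P p\<close> hold?'', with instances \<open>p\<close> presented to the
  machine as the word \<open>enc p\<close> over \<open>\<Sigma>\<close>.  It is a promise problem: nothing is required of the
  machine on words that do not encode an element of \<open>D\<close>.  Taking states and work tape symbols to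
  be natural numbers is no restriction, because there are only finitely many of each.
\<close>

definition solvable_linear_time_constant_space ::
  "'i set \<Rightarrow> ('p \<Rightarrow> 'i list) \<Rightarrow> 'p set \<Rightarrow> ('p \<Rightarrow> bool) \<Rightarrow> bool" where
  "solvable_linear_time_constant_space \<Sigma> enc D P \<longleftrightarrow>
     enc ` D \<subseteq> lists \<Sigma> \<and>
     (\<exists>(M :: (nat, 'i, nat) tm) (c :: nat) (d :: nat).
        turing_machine \<Sigma> M \<and>
        (\<forall>p \<in> D. \<exists>t.
           halts_at M (enc p) t \<and>
           (cfg_state (tm_config M (enc p) t) = tm_accept M \<longleftrightarrow> P p) \<and>
           t \<le> c * (length (enc p) + 1) \<and>
           work_space M (enc p) t \<le> d))"


datatype 'i pair_symbol = Sym 'i | Separator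

definition pair_alphabet :: "'i set \<Rightarrow> 'i pair_symbol set" where
  "pair_alphabet \<Sigma> = insert Separator (Sym ` \<Sigma>)"

definition encode_pair :: "'a letter list \<times> 'a \<Rightarrow> 'a letter pair_symbol list" where
  "encode_pair = (\<lambda>(u, x). map Sym u @ [Separator, Sym (Gen x)])"

end

theory Submission
  imports Defs
begin

text \<open>
  For geodesic \<open>u\<close> we have \<open>\<ell>(ux) > \<ell>(u)\<close> iff \<open>ux\<close> is itself geodesic, that is, iff the automaton
  accepts \<open>ux\<close>.  Its subset construction can be run by a Turing machine in one left-to-right sweep
  over the input without using the work tape; the separator between \<open>u\<close> and \<open>x\<close> is skipped.
\<close>

text \<open>States \<open>0\<close> and \<open>1\<close> accept and reject; state \<open>q\<close> of the automaton becomes \<open>f q + 2\<close>.\<close>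

definition sweep_tm ::
  "('s \<Rightarrow> nat) \<Rightarrow> 's set \<Rightarrow> ('s \<Rightarrow> 'i \<Rightarrow> 's) \<Rightarrow> 's \<Rightarrow> 's set \<Rightarrow> (nat, 'i, nat) tm" where
  "sweep_tm f Q \<delta> q0 F =
     \<lparr>tm_states = {0, 1} \<union> (\<lambda>q. f q + 2) ` Q, tm_work_alphabet = {0}, tm_blank = 0,
      tm_start = f q0 + 2, tm_accept = 0, tm_reject = 1,
      tm_delta = (\<lambda>s c _.
        if s < 2 then (s, 0, Stay, Stay)
        else let q = inv_into Q f (s - 2) in
          case c of LeftEnd \<Rightarrow> (s, 0, MoveRight, Stay)
          | Symbol a \<Rightarrow> (f (\<delta> q a) + 2, 0, MoveRight, Stay)
          | RightEnd \<Rightarrow> (if q \<in> F then 0 else 1, 0, Stay, Stay))\<rparr>"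

lemma foldl_closed:
  assumes "\<forall>q\<in>Q. \<forall>a\<in>\<Sigma>. \<delta> q a \<in> Q" and "q \<in> Q" and "w \<in> lists \<Sigma>"
  shows "foldl \<delta> q w \<in> Q"
  using assms(2,3) by (induction w arbitrary: q) (use assms(1) in auto)

lemma turing_machine_sweep_tm:
  assumes "finite \<Sigma>" "finite Q" "inj_on f Q" "q0 \<in> Q"
    and "\<forall>q\<in>Q. \<forall>a\<in>\<Sigma>. \<delta> q a \<in> Q"
  shows "turing_machine \<Sigma> (sweep_tm f Q \<delta> q0 F)"
  using assms by (auto simp: turing_machine_def sweep_tm_def)

text \<open>The first step only leaves the left end marker, so time \<open>Suc k\<close> is when
  exactly \<open>k\<close> letters have been read and the input head is on cell
  \<open>Suc k\<close>. Each further step reads one letter, and nothing but the blank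
  \<open>0\<close> is ever written.\<close>

lemma sweep_tm_config:
  assumes "inj_on f Q" and "q0 \<in> Q"
    and closed: "\<forall>q\<in>Q. \<forall>a\<in>\<Sigma>. \<delta> q a \<in> Q"
    and "w \<in> lists \<Sigma>" and "k \<le> length w"
  shows "tm_config (sweep_tm f Q \<delta> q0 F) w (Suc k) =
    \<lparr>cfg_state = f (foldl \<delta> q0 (take k w)) + 2, cfg_input_pos = Suc k,
     cfg_work_pos = 0, cfg_work_tape = (\<lambda>_. 0)\<rparr>"
  using assms(5)
proof (induction k)
  case 0
  show ?case
    by (auto simp: tm_config_def tm_step_def sweep_tm_def input_cell_def Let_def)
next
  case (Suc k)
  let ?M = "sweep_tm f Q \<delta> q0 F"
  \<comment> \<open>The current automaton state must lie in \<open>Q\<close>, since only there does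
    \<open>inv_into Q f\<close> recover it from its number.\<close>
  have "take k w \<in> lists \<Sigma>"
    using assms(4) by (auto dest: in_set_takeD)
  then have "foldl \<delta> q0 (take k w) \<in> Q"
    by (rule foldl_closed[OF closed assms(2)])
  moreover have "tm_config ?M w (Suc (Suc k)) = tm_step ?M w (tm_config ?M w (Suc k))"
    by (simp add: tm_config_def)
  ultimately show ?case
    using Suc assms(1)
    by (auto simp: tm_step_def sweep_tm_def input_cell_def Let_def take_Suc_conv_app_nth)
qed

text \<open>The \<open>2\<close> counts the two end markers: one step for each of them and one per
  letter. The last step reads the right end marker and gives the verdict without moving a
  head.\<close>

lemma sweep_tm_final_config:
  assumes "inj_on f Q" and "q0 \<in> Q"
    and closed: "\<forall>q\<in>Q. \<forall>a\<in>\<Sigma>. \<delta> q a \<in> Q"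
    and "w \<in> lists \<Sigma>"
  shows "tm_config (sweep_tm f Q \<delta> q0 F) w (length w + 2) =
    \<lparr>cfg_state = (if foldl \<delta> q0 w \<in> F then 0 else 1), cfg_input_pos = Suc (length w),
     cfg_work_pos = 0, cfg_work_tape = (\<lambda>_. 0)\<rparr>"
proof -
  let ?M = "sweep_tm f Q \<delta> q0 F"
  have "foldl \<delta> q0 w \<in> Q"
    by (rule foldl_closed[OF closed assms(2,4)])
  moreover have "tm_config ?M w (length w + 2) = tm_step ?M w (tm_config ?M w (Suc (length w)))"
    by (simp add: tm_config_def)
  ultimately show ?thesis
    using assms(1) sweep_tm_config[OF assms order_refl]
    by (auto simp: tm_step_def sweep_tm_def input_cell_def Let_def)
qed

lemma sweep_tm_run:
  fixes F :: "'s set"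
  assumes "inj_on f Q" and "q0 \<in> Q"
    and "\<forall>q\<in>Q. \<forall>a\<in>\<Sigma>. \<delta> q a \<in> Q"
    and "w \<in> lists \<Sigma>"
  defines "M \<equiv> sweep_tm f Q \<delta> q0 F"
  shows "halts_at M w (length w + 2)"
    and "cfg_state (tm_config M w (length w + 2)) = tm_accept M \<longleftrightarrow> foldl \<delta> q0 w \<in> F"
    and "work_space M w (length w + 2) \<le> 1"
proof -
  note final = sweep_tm_final_config[OF assms(1-4), where F = F, folded M_def]
  have M_simps: "tm_accept M = 0" "tm_reject M = 1"
    by (simp_all add: M_def sweep_tm_def)
  \<comment> \<open>Before the verdict every state is a number shifted by \<open>2\<close>, hence
    not halting. Time \<open>0\<close> is treated apart because \<open>sweep_tm_config\<close>
    starts at time \<open>1\<close>.\<close>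
  have running: "cfg_state (tm_config M w s) \<notin> {0, 1} \<and> cfg_work_pos (tm_config M w s) = 0"
    if "s < length w + 2" for s
  proof (cases s)
    case 0
    then show ?thesis
      by (simp add: tm_config_def M_def sweep_tm_def)
  next
    case (Suc k)
    then show ?thesis
      using that sweep_tm_config[OF assms(1-4), where k = k and F = F] by (simp add: M_def)
  qed
  show "halts_at M w (length w + 2)"
    unfolding halts_at_def halted_def M_simps
  proof (intro conjI allI impI)
    show "\<not> (cfg_state (tm_config M w s) = 0 \<or> cfg_state (tm_config M w s) = 1)"
      if "s < length w + 2" for s
      using running[OF that] by blast
  qed (simp add: final del: add_2_eq_Suc')
  show "cfg_state (tm_config M w (length w + 2)) = tm_accept M \<longleftrightarrow> foldl \<delta> q0 w \<in> F"
    using final by (simp add: M_simps del: add_2_eq_Suc')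
  have "(\<lambda>s. cfg_work_pos (tm_config M w s)) ` {..length w + 2} \<subseteq> {0}"
  proof (rule image_subsetI)
    show "cfg_work_pos (tm_config M w s) \<in> {0}" if "s \<in> {..length w + 2}" for s
      using that running[of s] final by (cases "s = length w + 2") (simp_all del: add_2_eq_Suc')
  qed
  then show "work_space M w (length w + 2) \<le> 1"
    unfolding work_space_def using card_mono[of "{0::int}"] by simp
qed

text \<open>Any finite state type is allowed here: an injection \<open>f\<close> into the naturals
  supplies the numbering that the machine model asks for.\<close>

lemma solvable_by_deterministic_automaton:
  fixes Q :: "'s set" and \<delta> :: "'s \<Rightarrow> 'i \<Rightarrow> 's"
  assumes "finite \<Sigma>" and "finite Q" and "q0 \<in> Q"
    and closed: "\<forall>q\<in>Q. \<forall>a\<in>\<Sigma>. \<delta> q a \<in> Q"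
    and enc: "enc ` D \<subseteq> lists \<Sigma>"
    and correct: "\<And>p. p \<in> D \<Longrightarrow> foldl \<delta> q0 (enc p) \<in> F \<longleftrightarrow> P p"
  shows "solvable_linear_time_constant_space \<Sigma> enc D P"
proof -
  obtain f :: "'s \<Rightarrow> nat" where f: "inj_on f Q"
    using finite_imp_inj_to_nat_seg[OF \<open>finite Q\<close>] by blast
  define M where "M = sweep_tm f Q \<delta> q0 F"
  have "turing_machine \<Sigma> M"
    unfolding M_def using assms(1,2) f assms(3) closed by (rule turing_machine_sweep_tm)
  \<comment> \<open>The run takes \<open>length (enc p) + 2\<close> steps, which factor
    \<open>2\<close> covers even for an empty encoding; the work head stays on one cell.\<close>
  moreover have "\<exists>t. halts_at M (enc p) t \<and>
      (cfg_state (tm_config M (enc p) t) = tm_accept M \<longleftrightarrow> P p) \<and>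
      t \<le> 2 * (length (enc p) + 1) \<and> work_space M (enc p) t \<le> 1" if "p \<in> D" for p
  proof -
    have "enc p \<in> lists \<Sigma>"
      using enc that by blast
    note run = sweep_tm_run[OF f \<open>q0 \<in> Q\<close> closed this, where F = F, folded M_def]
    show ?thesis
      by (rule exI[of _ "length (enc p) + 2"]) (use run correct[OF that] in simp)
  qed
  ultimately show ?thesis
    unfolding solvable_linear_time_constant_space_def using enc by blast
qed

text \<open>Sets of states make the step deterministic and total: where the automaton has no
  transition, the result is the empty set.\<close>

fun subset_step :: "('q, 'i) fsa \<Rightarrow> 'q set \<Rightarrow> 'i pair_symbol \<Rightarrow> 'q set" where
  "subset_step A X (Sym a) = {r. \<exists>q\<in>X. (q, a, r) \<in> fsa_trans A}"
| "subset_step A X Separator = X"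

lemma foldl_subset_step_map_Sym:
  "foldl (subset_step A) X (map Sym w) = {r. \<exists>q\<in>X. fsa_path A q w r}"
  by (induction w arbitrary: X) auto

lemma foldl_subset_step_encode_pair:
  "foldl (subset_step A) X (encode_pair (u, x)) = {r. \<exists>q\<in>X. fsa_path A q (u @ [Gen x]) r}"
proof -
  have "foldl (subset_step A) X (encode_pair (u, x)) =
      foldl (subset_step A) X (map Sym (u @ [Gen x]))"
    by (simp add: encode_pair_def)
  then show ?thesis
    by (simp only: foldl_subset_step_map_Sym)
qed

lemma word_length_le_length:
  "w \<in> lists (letters S) \<Longrightarrow> word_length G S w \<le> length w"
  unfolding word_length_def by (rule Least_le) blast

text \<open>Since \<ell>(ua) is at most the length of ua, which is \<ell>(u) + 1 for geodesic u,
  exceeding \<ell>(u) forces equality with that length.\<close>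

lemma geodesic_snoc_iff:
  assumes "geodesic G S u" and "a \<in> letters S"
  shows "geodesic G S (u @ [a]) \<longleftrightarrow> word_length G S (u @ [a]) > word_length G S u"
  using assms word_length_le_length[of "u @ [a]" S G] by (auto simp: geodesic_def)

theorem proposition4:
  fixes G :: "('a, 'm) monoid_scheme"
    and S :: "'a set"
    and A :: "('q, 'a letter) fsa"
  assumes "group G"
    and "finite S"
    and "S \<subseteq> carrier G"
    and "generate G S = carrier G"
    and "finite_state_automaton (letters S) A"
    and "fsa_language A = {w. geodesic G S w}"
  shows "solvable_linear_time_constant_space
           (pair_alphabet (letters S)) encode_pair
           {(u, x). geodesic G S u \<and> x \<in> S}
           (\<lambda>(u, x). word_length G S (u @ [Gen x]) > word_length G S u)"
proof (rule solvable_by_deterministic_automaton)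
  note fsa = assms(5)[unfolded finite_state_automaton_def]
  show "finite (pair_alphabet (letters S))"
    using fsa by (simp add: pair_alphabet_def)
  show "finite (Pow (fsa_states A))" "fsa_init A \<in> Pow (fsa_states A)"
    using fsa by auto
  have "subset_step A X c \<in> Pow (fsa_states A)" if "X \<in> Pow (fsa_states A)" for X c
    using that fsa by (cases c) auto
  then show "\<forall>X\<in>Pow (fsa_states A). \<forall>c\<in>pair_alphabet (letters S).
      subset_step A X c \<in> Pow (fsa_states A)"
    by blast
  show "encode_pair ` {(u, x). geodesic G S u \<and> x \<in> S} \<subseteq> lists (pair_alphabet (letters S))"
    by (auto simp: encode_pair_def pair_alphabet_def geodesic_def letters_def)
  show "foldl (subset_step A) (fsa_init A) (encode_pair p) \<in> {X. X \<inter> fsa_final A \<noteq> {}} \<longleftrightarrow>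
      (case p of (u, x) \<Rightarrow> word_length G S (u @ [Gen x]) > word_length G S u)"
    if instance_p: "p \<in> {(u, x). geodesic G S u \<and> x \<in> S}" for p
  proof -
    obtain u x where p: "p = (u, x)" "geodesic G S u" "Gen x \<in> letters S"
      using instance_p by (auto simp: letters_def)
    \<comment> \<open>Started from all initial states, the set reached meets
      \<open>fsa_final A\<close> exactly when some accepting path is labelled by ux.\<close>
    have "foldl (subset_step A) (fsa_init A) (encode_pair p) \<inter> fsa_final A \<noteq> {} \<longleftrightarrow>
        u @ [Gen x] \<in> fsa_language A"
      unfolding p(1) foldl_subset_step_encode_pair fsa_language_def by blast
    then show ?thesis
      using assms(6) geodesic_snoc_iff[OF p(2,3)] p(1) by simp
  qed
qed

end
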